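(* Let $\Gamma$ be a first-order expansion of $(\mathbb Q;+)$. Then either (i) each relation in $\Gamma$ has a quantifier-free Horn definition in $(\mathbb Q;+)$, or (ii) every non-empty relation of $\Gamma$ contains a tuple of the form $(0,\dots,0)$, or (iii) every relation that is first-order definable in $(\mathbb Q;+)$ has a primitive positive definition in $\Gamma$.
   Context: $(\mathbb Q;+)$ denotes the structure $(\mathbb Q;\{(x,y,z)\mid x+y=z\})$. A first-order expansion of $(\mathbb Q;+)$ is a relational structure with domain $\mathbb Q$ whose relations include $\{(x,y,z)\mid x+y=z\}$ and are all first-order definable in $(\mathbb Q;+)$. A quantifier-free Horn definition is a quantifier-free formula in conjunctive normal form, each clause containing at most one positive literal, with atoms of the form $x+y=z$ or $x=y$. A primitive positive definition in $\Gamma$ is a formula $\exists x_1,\dots,x_n.\,\psi_1\wedge\dots\wedge\psi_m$ with each $\psi_i$ an atomic formula $x=y$ or $R(x_{i_1},\dots,x_{i_k})$ for a relation $R$ of $\Gamma$.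
   Formalization: In Horn definitions, the letters in atoms x+y=z and x=y may stand for sums of variables (integer linear equations); with variables only the claim is false, e.g. for Γ = (Q; +, {(x,y) | y=3x}, {x | x≠0}). *)

theory Defs
  imports Complex_Main
begin

text \<open>
  A relational structure whose domain is the whole type \<open>'a\<close> and whose relation symbols are the
  elements of \<open>'s\<close>. Relations are sets of lists; the arity is stored separately because an empty
  relation does not determine it.
\<close>

record ('s, 'a) rel_structure =
  ar :: "'s \<Rightarrow> nat"
  rel :: "'s \<Rightarrow> 'a list set"

definition wf_structure :: "('s, 'a) rel_structure \<Rightarrow> bool" where
  "wf_structure \<Gamma> \<longleftrightarrow> (\<forall>r. \<forall>t \<in> rel \<Gamma> r. length t = ar \<Gamma> r)"

datatype 's atomic = Eq nat nat | Rel 's "nat list"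

fun wf_atomic :: "('s, 'a) rel_structure \<Rightarrow> 's atomic \<Rightarrow> bool" where
  "wf_atomic \<Gamma> (Eq x y) = True"
| "wf_atomic \<Gamma> (Rel r xs) = (length xs = ar \<Gamma> r)"

fun vars_atomic :: "'s atomic \<Rightarrow> nat set" where
  "vars_atomic (Eq x y) = {x, y}"
| "vars_atomic (Rel r xs) = set xs"

fun sat_atomic :: "('s, 'a) rel_structure \<Rightarrow> (nat \<Rightarrow> 'a) \<Rightarrow> 's atomic \<Rightarrow> bool" where
  "sat_atomic \<Gamma> e (Eq x y) = (e x = e y)"
| "sat_atomic \<Gamma> e (Rel r xs) = (map e xs \<in> rel \<Gamma> r)"

datatype 's fo = Atom "'s atomic" | Neg "'s fo" | Conj "'s fo" "'s fo" | Ex nat "'s fo"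

fun wf_fo :: "('s, 'a) rel_structure \<Rightarrow> 's fo \<Rightarrow> bool" where
  "wf_fo \<Gamma> (Atom a) = wf_atomic \<Gamma> a"
| "wf_fo \<Gamma> (Neg \<phi>) = wf_fo \<Gamma> \<phi>"
| "wf_fo \<Gamma> (Conj \<phi> \<psi>) = (wf_fo \<Gamma> \<phi> \<and> wf_fo \<Gamma> \<psi>)"
| "wf_fo \<Gamma> (Ex x \<phi>) = wf_fo \<Gamma> \<phi>"

fun free_vars :: "'s fo \<Rightarrow> nat set" where
  "free_vars (Atom a) = vars_atomic a"
| "free_vars (Neg \<phi>) = free_vars \<phi>"
| "free_vars (Conj \<phi> \<psi>) = free_vars \<phi> \<union> free_vars \<psi>"
| "free_vars (Ex x \<phi>) = free_vars \<phi> - {x}"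

fun sat :: "('s, 'a) rel_structure \<Rightarrow> (nat \<Rightarrow> 'a) \<Rightarrow> 's fo \<Rightarrow> bool" where
  "sat \<Gamma> e (Atom a) = sat_atomic \<Gamma> e a"
| "sat \<Gamma> e (Neg \<phi>) = (\<not> sat \<Gamma> e \<phi>)"
| "sat \<Gamma> e (Conj \<phi> \<psi>) = (sat \<Gamma> e \<phi> \<and> sat \<Gamma> e \<psi>)"
| "sat \<Gamma> e (Ex x \<phi>) = (\<exists>a. sat \<Gamma> (e(x := a)) \<phi>)"

text \<open>
  The \<open>k\<close>-ary relation defined by a condition on assignments; it is only used for formulas whose
  free variables are among \<open>0, \<dots>, k - 1\<close>, where the other values of the assignment are irrelevant.
\<close>

definition defined_rel :: "nat \<Rightarrow> ((nat \<Rightarrow> 'a) \<Rightarrow> bool) \<Rightarrow> 'a list set" where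
  "defined_rel k P = {map e [0..<k] | e. P e}"

definition fo_definable :: "('s, 'a) rel_structure \<Rightarrow> nat \<Rightarrow> 'a list set \<Rightarrow> bool" where
  "fo_definable \<Gamma> k R \<longleftrightarrow>
     (\<exists>\<phi>. wf_fo \<Gamma> \<phi> \<and> free_vars \<phi> \<subseteq> {..<k} \<and> R = defined_rel k (\<lambda>e. sat \<Gamma> e \<phi>))"

text \<open>
  A primitive positive formula with free variables \<open>0, \<dots>, k - 1\<close> and existentially quantified
  variables \<open>k, \<dots>, k + n - 1\<close>, given by the list of its conjuncts.
\<close>

definition pp_definable :: "('s, 'a) rel_structure \<Rightarrow> nat \<Rightarrow> 'a list set \<Rightarrow> bool" where
  "pp_definable \<Gamma> k R \<longleftrightarrow>
     (\<exists>n \<psi>s. (\<forall>\<psi> \<in> set \<psi>s. wf_atomic \<Gamma> \<psi> \<and> vars_atomic \<psi> \<subseteq> {..<k + n}) \<and>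
        R = defined_rel k (\<lambda>e. \<exists>e'. (\<forall>i<k. e' i = e i) \<and> (\<forall>\<psi> \<in> set \<psi>s. sat_atomic \<Gamma> e' \<psi>)))"

definition plus_rel :: "rat list set" where
  "plus_rel = {[x, y, z] | x y z. x + y = z}"

definition Q_plus :: "(unit, rat) rel_structure" where
  "Q_plus = \<lparr>ar = (\<lambda>_. 3), rel = (\<lambda>_. plus_rel)\<rparr>"

definition fo_expansion_Q_plus :: "('s, rat) rel_structure \<Rightarrow> bool" where
  "fo_expansion_Q_plus \<Gamma> \<longleftrightarrow>
     wf_structure \<Gamma> \<and> (\<exists>r. ar \<Gamma> r = 3 \<and> rel \<Gamma> r = plus_rel) \<and>
     (\<forall>r. fo_definable Q_plus (ar \<Gamma> r) (rel \<Gamma> r))"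

text \<open>
  Quantifier-free formulas over \<open>(\<rat>;+)\<close> are built from equations between terms in the binary
  function symbol \<open>+\<close>, so that in the atoms \<open>x + y = z\<close> and \<open>x = y\<close> the letters may stand for
  sums of variables. Without nested sums there would be no quantifier-free definition of, for
  example, \<open>{(x, y). y = x + x + x}\<close>: no auxiliary variable is available for \<open>x + x\<close>.
\<close>

datatype add_term = Var nat | Plus add_term add_term

fun vars_term :: "add_term \<Rightarrow> nat set" where
  "vars_term (Var x) = {x}"
| "vars_term (Plus s t) = vars_term s \<union> vars_term t"

fun eval_term :: "(nat \<Rightarrow> rat) \<Rightarrow> add_term \<Rightarrow> rat" where
  "eval_term e (Var x) = e x"
| "eval_term e (Plus s t) = eval_term e s + eval_term e t"

datatype literal = PosEq add_term add_term | NegEq add_term add_term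

fun is_positive :: "literal \<Rightarrow> bool" where
  "is_positive (PosEq s t) = True"
| "is_positive (NegEq s t) = False"

fun vars_literal :: "literal \<Rightarrow> nat set" where
  "vars_literal (PosEq s t) = vars_term s \<union> vars_term t"
| "vars_literal (NegEq s t) = vars_term s \<union> vars_term t"

fun sat_literal :: "(nat \<Rightarrow> rat) \<Rightarrow> literal \<Rightarrow> bool" where
  "sat_literal e (PosEq s t) = (eval_term e s = eval_term e t)"
| "sat_literal e (NegEq s t) = (eval_term e s \<noteq> eval_term e t)"

type_synonym clause = "literal list"
type_synonym cnf = "clause list"

definition sat_cnf :: "(nat \<Rightarrow> rat) \<Rightarrow> cnf \<Rightarrow> bool" where
  "sat_cnf e cs \<longleftrightarrow> (\<forall>c \<in> set cs. \<exists>l \<in> set c. sat_literal e l)"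

definition horn_cnf :: "cnf \<Rightarrow> bool" where
  "horn_cnf cs \<longleftrightarrow> (\<forall>c \<in> set cs. length (filter is_positive c) \<le> 1)"

definition qf_horn_definable_Q_plus :: "nat \<Rightarrow> rat list set \<Rightarrow> bool" where
  "qf_horn_definable_Q_plus k R \<longleftrightarrow>
     (\<exists>cs. horn_cnf cs \<and> (\<forall>c \<in> set cs. \<forall>l \<in> set c. vars_literal l \<subseteq> {..<k}) \<and>
        R = defined_rel k (\<lambda>e. sat_cnf e cs))"

end

(*
  Quantifier elimination shows that membership in a definable relation R depends only on which forms
  of a finite set F of linear forms vanish at the tuple. If the zero sets realised in R are closed under
  intersection, R is defined by Horn clauses. Otherwise there are a, b in R such that x a + y b lies
  in R on the two axes of the (x, y)-plane but on only finitely many other lines through the origin.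
  A relation without the zero tuple gives a primitive positive definition of x \<noteq> 0; together these
  define "exactly one of x, y is zero". This is a negation on the encoding of truth values by zero
  and nonzero numbers, addition serves as disjunction, and all definable relations follow.
*)
theory Submission imports Defs begin

text \<open>Nonzero scaling does not change which forms vanish, so only lines through the origin
  matter. A form with value u at a and v \<noteq> 0 at b vanishes at x a + y b, x \<noteq> 0, for
  the single ratio y / x = - u / v. With finitely many forms, all but finitely many ratios thus give
  exactly the common zeros of a and b. If no tuple of R has these as its zero set, only exceptional
  lines and the axes are left; a generic stretch of the y-axis moves the exceptional lines off each
  other. The origin cannot be removed this way. For it x \<noteq> 0 is needed, which may come from
  another relation than the one that violates closure under intersection. Truth has many codes, and
  the codes of two true statements may cancel. Hence a sum cannot serve as the code of a
  disjunction; it only asserts one, because the quantifier may choose codes that do not cancel. The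
  code of a disjunction is then described by clauses.\<close>

section \<open>Linear forms, zero sets and constructible predicates\<close>

definition lin :: "nat set \<Rightarrow> (nat \<Rightarrow> rat) \<Rightarrow> (nat \<Rightarrow> rat) \<Rightarrow> rat" where
  "lin V c e = (\<Sum>i\<in>V. c i * e i)"

definition zeros :: "nat set \<Rightarrow> (nat \<Rightarrow> rat) set \<Rightarrow> (nat \<Rightarrow> rat) \<Rightarrow> (nat \<Rightarrow> rat) set" where
  "zeros V F e = {c \<in> F. lin V c e = 0}"

text \<open>A semantic rendering of "Boolean combination of the equations
  \<open>lin V c e = 0\<close> with \<open>c \<in> F\<close>": closure under the connectives then
  needs no normal form.\<close>

definition determined_by :: "nat set \<Rightarrow> (nat \<Rightarrow> rat) set \<Rightarrow> ((nat \<Rightarrow> rat) \<Rightarrow> bool) \<Rightarrow> bool" where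
  "determined_by V F P \<longleftrightarrow> finite F \<and> (\<forall>e e'. zeros V F e = zeros V F e' \<longrightarrow> P e = P e')"

definition constructible :: "nat set \<Rightarrow> ((nat \<Rightarrow> rat) \<Rightarrow> bool) \<Rightarrow> bool" where
  "constructible V P \<longleftrightarrow> (\<exists>F. determined_by V F P)"

lemma lin_cong: "(\<And>i. i \<in> V \<Longrightarrow> e i = e' i) \<Longrightarrow> lin V c e = lin V c e'"
  unfolding lin_def by (rule sum.cong) auto

lemma lin_comb: "lin V c (\<lambda>i. s * a i + t * b i) = s * lin V c a + t * lin V c b"
  by (simp add: lin_def sum_distrib_left sum.distrib algebra_simps)

lemma lin_comb_coeffs: "lin V (\<lambda>i. s * c i + t * d i) e = s * lin V c e + t * lin V d e"
  by (simp add: lin_def sum_distrib_left sum.distrib algebra_simps)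

lemma lin_unit:
  assumes "finite V" "x \<in> V"
  shows "lin V (\<lambda>i. if i = x then q else 0) e = q * e x"
  using assms by (simp add: lin_def if_distrib[of "\<lambda>a. a * _"] cong: if_cong)

lemma lin_upd:
  assumes "finite V" "x \<in> V"
  shows "lin V c (e(x := a)) = c x * a + lin (V - {x}) c e"
proof -
  have "lin V c (e(x := a)) = c x * a + lin (V - {x}) c (e(x := a))"
    using assms by (simp add: lin_def sum.remove[of V x])
  also have "lin (V - {x}) c (e(x := a)) = lin (V - {x}) c e"
    by (rule lin_cong) auto
  finally show ?thesis .
qed

lemma zeros_mono_eq: "F \<subseteq> G \<Longrightarrow> zeros V G e = zeros V G e' \<Longrightarrow> zeros V F e = zeros V F e'"
  unfolding zeros_def by blast

lemma zeros_iff: "zeros V F e = zeros V F e' \<Longrightarrow> c \<in> F \<Longrightarrow> lin V c e = 0 \<longleftrightarrow> lin V c e' = 0"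
  unfolding zeros_def by blast

lemma determined_byD: "determined_by V F P \<Longrightarrow> zeros V F e = zeros V F e' \<Longrightarrow> P e = P e'"
  unfolding determined_by_def by blast

lemma determined_by_not: "determined_by V F P \<Longrightarrow> determined_by V F (\<lambda>e. \<not> P e)"
  unfolding determined_by_def by blast

lemma determined_by_mono: "determined_by V F P \<Longrightarrow> F \<subseteq> G \<Longrightarrow> finite G \<Longrightarrow> determined_by V G P"
  unfolding determined_by_def using zeros_mono_eq by metis

lemma constructible_conj:
  assumes "constructible V P" "constructible V Q"
  shows "constructible V (\<lambda>e. P e \<and> Q e)"
proof -
  obtain F G where FG: "determined_by V F P" "determined_by V G Q"
    using assms by (auto simp: constructible_def)
  then have fin: "finite (F \<union> G)" by (auto simp: determined_by_def)
  have "determined_by V (F \<union> G) P" "determined_by V (F \<union> G) Q"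
    using FG fin by (auto intro: determined_by_mono)
  then have "determined_by V (F \<union> G) (\<lambda>e. P e \<and> Q e)"
    unfolding determined_by_def by blast
  then show ?thesis by (auto simp: constructible_def)
qed

lemma constructible_lin: "constructible V (\<lambda>e. lin V c e = 0)"
  unfolding constructible_def determined_by_def
  by (rule exI[of _ "{c}"]) (auto simp: zeros_def)

text \<open>The coefficients of a form over V are arbitrary outside V. They must be cut off to zero
  (\<open>h\<close>) before the sum may run over W.\<close>

lemma constructible_mono:
  assumes "constructible V P" "V \<subseteq> W" "finite W"
  shows "constructible W P"
proof -
  obtain F where F: "determined_by V F P" using assms by (auto simp: constructible_def)
  define h where "h c = (\<lambda>i. if i \<in> V then c i else (0::rat))" for c
  have lin_h: "lin W (h c) e = lin V c e" for c e
  proof -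
    have "lin W (h c) e = (\<Sum>i\<in>W. if i \<in> V then c i * e i else 0)"
      unfolding lin_def by (rule sum.cong) (auto simp: h_def)
    also have "\<dots> = lin V c e"
      using assms by (simp add: lin_def sum.inter_restrict[symmetric] Int_absorb1)
    finally show ?thesis .
  qed
  have "determined_by W (h ` F) P"
    unfolding determined_by_def
  proof (intro conjI allI impI)
    show "finite (h ` F)" using F by (simp add: determined_by_def)
    fix e e' assume "zeros W (h ` F) e = zeros W (h ` F) e'"
    then have "lin V c e = 0 \<longleftrightarrow> lin V c e' = 0" if "c \<in> F" for c
      using zeros_iff[of W "h ` F" e e' "h c"] that by (simp add: lin_h)
    then have "zeros V F e = zeros V F e'" by (auto simp: zeros_def)
    then show "P e = P e'" by (rule determined_byD[OF F])
  qed
  then show ?thesis by (auto simp: constructible_def)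
qed

lemma determined_by_local:
  assumes "determined_by V F P" "\<And>i. i \<in> V \<Longrightarrow> e i = e' i"
  shows "P e = P e'"
proof -
  have "zeros V F e = zeros V F e'"
    unfolding zeros_def using lin_cong[of V e e', OF assms(2)] by simp
  then show ?thesis by (rule determined_byD[OF assms(1)])
qed

section \<open>Quantifier elimination for the rationals with addition\<close>

text \<open>
  Quantifier elimination. The forms \<open>c - (c x / d x) d\<close> decide which forms vanish once \<open>x\<close> is
  chosen as the zero of \<open>d\<close>; a witness that is a zero of no form containing \<open>x\<close> can be replaced by
  any other such value, and \<open>\<rat>\<close> is infinite.
\<close>

lemma constructible_ex:
  assumes con: "constructible V P" and fin: "finite V"
  shows "constructible (V - {x}) (\<lambda>e. \<exists>a. P (e(x := a)))"
proof (cases "x \<in> V")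
  case False
  obtain F where F: "determined_by V F P" using con by (auto simp: constructible_def)
  have "P (e(x := a)) = P e" for e a
    by (rule determined_by_local[OF F]) (use False in auto)
  then show ?thesis using con False by simp
next
  case True
  obtain F where F: "determined_by V F P" using con by (auto simp: constructible_def)
  then have finF: "finite F" by (simp add: determined_by_def)
  define W where "W = V - {x}"
  \<comment> \<open>The factor 1 gives the expression the shape of
    \<open>lin_comb_coeffs\<close>.\<close>
  define el where "el c d = (\<lambda>i. 1 * c i + (- (c x / d x)) * d i)" for c d :: "nat \<Rightarrow> rat"
  define G where "G = F \<union> (\<lambda>(c, d). el c d) ` (F \<times> F)"
  have finG: "finite G" using finF by (auto simp: G_def)
  have upd: "lin V c (e(x := a)) = c x * a + lin W c e" for c e a
    unfolding W_def by (rule lin_upd[OF fin True])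
  \<comment> \<open>One direction suffices, since e and e' can be exchanged.\<close>
  have transfer: "\<exists>a'. P (e'(x := a'))"
    if z: "zeros W G e = zeros W G e'" and Pa: "P (e(x := a))" for e e' a
  proof -
    have zG: "lin W c e = 0 \<longleftrightarrow> lin W c e' = 0" if "c \<in> G" for c
      using zeros_iff[OF z that] .
    have "\<exists>a'. \<forall>c\<in>F. lin V c (e(x := a)) = 0 \<longleftrightarrow> lin V c (e'(x := a')) = 0"
    proof (cases "\<exists>d\<in>F. d x \<noteq> 0 \<and> lin V d (e(x := a)) = 0")
      case True
      then obtain d where d: "d \<in> F" "d x \<noteq> 0" "d x * a + lin W d e = 0"
        by (auto simp: upd)
      have a: "a = - lin W d e / d x"
        using d by (simp add: field_simps add_eq_0_iff)
      have "lin V c (e(x := a)) = 0 \<longleftrightarrow> lin V c (e'(x := - lin W d e' / d x)) = 0"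
        if "c \<in> F" for c
      proof -
        have "el c d \<in> G" using that d(1) by (auto simp: G_def)
        then have "lin W (el c d) e = 0 \<longleftrightarrow> lin W (el c d) e' = 0" by (rule zG)
        moreover have "lin V c (f(x := - lin W d f / d x)) = lin W (el c d) f" for f
          unfolding el_def lin_comb_coeffs upd by simp
        ultimately show ?thesis unfolding a by simp
      qed
      then show ?thesis by blast
    next
      case False
      define B where "B = (\<lambda>c. - lin W c e' / c x) ` F"
      have "finite B" using finF by (simp add: B_def)
      then obtain a' where a': "a' \<notin> B"
        using ex_new_if_finite[OF infinite_UNIV_char_0] by blast
      have "lin V c (e(x := a)) = 0 \<longleftrightarrow> lin V c (e'(x := a')) = 0" if "c \<in> F" for c
      proof (cases "c x = 0")
        case True
        \<comment> \<open>A form without x is not affected by the choice of a'; for such forms G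
          contains F itself.\<close>
        then show ?thesis using zG[of c] that by (simp add: upd G_def)
      next
        case c: False
        have "lin V c (e'(x := a')) \<noteq> 0"
        proof
          assume "lin V c (e'(x := a')) = 0"
          then have "a' = - lin W c e' / c x"
            using c by (simp add: upd field_simps add_eq_0_iff)
          then show False using a' that by (auto simp: B_def)
        qed
        then show ?thesis using False c that by auto
      qed
      then show ?thesis by blast
    qed
    then obtain a' where "zeros V F (e(x := a)) = zeros V F (e'(x := a'))"
      by (auto simp: zeros_def)
    then have "P (e'(x := a'))" using determined_byD[OF F] Pa by blast
    then show ?thesis ..
  qed
  have "determined_by W G (\<lambda>e. \<exists>a. P (e(x := a)))"
    unfolding determined_by_def using finG transfer by metis
  then show ?thesis by (auto simp: constructible_def W_def)
qed

lemma finite_free_vars: "finite (free_vars \<phi>)"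
proof (induction \<phi>)
  case (Atom a)
  then show ?case by (cases a) auto
qed auto

lemma constructible_sat: "wf_fo Q_plus \<phi> \<Longrightarrow> constructible (free_vars \<phi>) (\<lambda>e. sat Q_plus e \<phi>)"
proof (induction \<phi>)
  case (Atom a)
  define V where "V = vars_atomic a"
  have finV: "finite V" using finite_free_vars[of "Atom a"] by (simp add: V_def)
  have "\<exists>c. \<forall>e. sat_atomic Q_plus e a \<longleftrightarrow> lin V c e = 0"
  proof (cases a)
    case (Eq x y)
    then have V: "x \<in> V" "y \<in> V" by (auto simp: V_def)
    \<comment> \<open>The form is a combination of unit vectors rather than a case distinction on
      the index: variables of an atom may coincide, and then their coefficients have to add
      up.\<close>
    show ?thesis
      using Eq V finV
      by (intro exI[of _ "\<lambda>i. 1 * (if i = x then 1 else 0) + (-1) * (if i = y then 1 else 0)"])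
        (simp only: lin_comb_coeffs lin_unit, simp)
  next
    case (Rel r xs)
    then have "length xs = 3" using Atom by (simp add: Q_plus_def)
    then obtain x y z where xs: "xs = [x, y, z]"
      by (auto simp: numeral_3_eq_3 length_Suc_conv)
    then have V: "x \<in> V" "y \<in> V" "z \<in> V" by (auto simp: V_def Rel)
    show ?thesis
      using Rel V finV
      by (intro exI[of _ "\<lambda>i. 1 * (1 * (if i = x then 1 else 0) + 1 * (if i = y then 1 else 0))
              + (-1) * (if i = z then 1 else 0)"])
        (simp only: lin_comb_coeffs lin_unit, auto simp: xs Q_plus_def plus_rel_def)
  qed
  then obtain c where "\<forall>e. sat_atomic Q_plus e a \<longleftrightarrow> lin V c e = 0" ..
  then show ?case using constructible_lin[of V c] by (simp add: V_def)
next
  case (Neg \<phi>)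
  then show ?case by (auto simp: constructible_def dest: determined_by_not)
next
  case (Conj \<phi> \<psi>)
  have "constructible (free_vars \<phi> \<union> free_vars \<psi>) (\<lambda>e. sat Q_plus e \<phi>)"
    "constructible (free_vars \<phi> \<union> free_vars \<psi>) (\<lambda>e. sat Q_plus e \<psi>)"
    using Conj by (auto intro: constructible_mono simp: finite_free_vars)
  then show ?case by (simp add: constructible_conj)
next
  case (Ex x \<phi>)
  then show ?case using constructible_ex[OF _ finite_free_vars, of \<phi> "\<lambda>e. sat Q_plus e \<phi>" x] by simp
qed

text \<open>By \<open>defined_rel\<close> a tuple of R is represented by some assignment satisfying
  P. As P ignores all values outside \<open>{..<k}\<close>, every representing assignment satisfies
  it; this third conclusion is the bridge between relations and predicates.\<close>

lemma fo_definable_determined: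
  assumes "fo_definable Q_plus k R"
  obtains F P where "determined_by {..<k} F P" "R = defined_rel k P"
    "\<And>e. map e [0..<k] \<in> R \<longleftrightarrow> P e"
proof -
  obtain \<phi> where \<phi>: "wf_fo Q_plus \<phi>" "free_vars \<phi> \<subseteq> {..<k}" "R = defined_rel k (\<lambda>e. sat Q_plus e \<phi>)"
    using assms by (auto simp: fo_definable_def)
  have "constructible {..<k} (\<lambda>e. sat Q_plus e \<phi>)"
    using constructible_mono[OF constructible_sat] \<phi> by blast
  then obtain F where F: "determined_by {..<k} F (\<lambda>e. sat Q_plus e \<phi>)"
    by (auto simp: constructible_def)
  have "map e [0..<k] \<in> R \<longleftrightarrow> sat Q_plus e \<phi>" for e
  proof
    assume "map e [0..<k] \<in> R"
    then obtain e' where e': "map e [0..<k] = map e' [0..<k]" "sat Q_plus e' \<phi>"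
      by (auto simp: \<phi>(3) defined_rel_def)
    then have "e i = e' i" if "i < k" for i using that by simp
    then show "sat Q_plus e \<phi>" using determined_by_local[OF F, of e e'] e' by simp
  qed (auto simp: \<phi>(3) defined_rel_def)
  then show thesis using that F \<phi>(3) by blast
qed

section \<open>Zero sets of multiples and of generic combinations\<close>

lemma zeros_scale: "s \<noteq> 0 \<Longrightarrow> zeros V F (\<lambda>i. s * a i) = zeros V F a"
  using lin_comb[of V _ s a 0 a] by (simp add: zeros_def)

lemma determined_by_scale: "determined_by V F P \<Longrightarrow> s \<noteq> 0 \<Longrightarrow> P (\<lambda>i. s * a i) = P a"
  using zeros_scale unfolding determined_by_def by blast

text \<open>A form that is nonzero at b vanishes at a + t b for one t only, while a form that
  vanishes at b has the value \<open>lin V c a\<close> for every t. Finiteness of F leaves finitely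
  many exceptional t.\<close>

lemma zeros_generic_comb:
  assumes "finite F"
  shows "finite {t. zeros V F (\<lambda>i. a i + t * b i) \<noteq> zeros V F a \<inter> zeros V F b}"
proof (rule finite_subset)
  show "finite (insert 0 ((\<lambda>c. - lin V c a / lin V c b) ` F))" using assms by simp
  have lin: "lin V c (\<lambda>i. a i + t * b i) = lin V c a + t * lin V c b" for c t
    using lin_comb[of V c 1 a t b] by simp
  show "{t. zeros V F (\<lambda>i. a i + t * b i) \<noteq> zeros V F a \<inter> zeros V F b}
      \<subseteq> insert 0 ((\<lambda>c. - lin V c a / lin V c b) ` F)" (is "?L \<subseteq> ?B")
  proof (rule subsetI, rule ccontr)
    fix t assume t: "t \<in> ?L" "t \<notin> ?B"
    have "lin V c a + t * lin V c b = 0 \<longleftrightarrow> lin V c a = 0 \<and> lin V c b = 0" if "c \<in> F" for c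
    proof (cases "lin V c b = 0")
      case False
      have "t \<noteq> - lin V c a / lin V c b" using t that by auto
      then show ?thesis using False by (auto simp: field_simps add_eq_0_iff)
    qed auto
    then have "zeros V F (\<lambda>i. a i + t * b i) = zeros V F a \<inter> zeros V F b"
      by (auto simp: zeros_def lin)
    then show False using t by simp
  qed
qed

section \<open>Primitive positive predicates and their closure properties\<close>

text \<open>The counterpart of \<open>pp_definable\<close> for predicates on assignments instead of
  sets of lists, so that renaming and substitution become composition of functions.\<close>

definition pp_pred :: "('s, 'a) rel_structure \<Rightarrow> nat \<Rightarrow> ((nat \<Rightarrow> 'a) \<Rightarrow> bool) \<Rightarrow> bool" where
  "pp_pred \<Gamma> k P \<longleftrightarrow>
     (\<exists>n \<psi>s. (\<forall>\<psi> \<in> set \<psi>s. wf_atomic \<Gamma> \<psi> \<and> vars_atomic \<psi> \<subseteq> {..<k + n}) \<and>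
        (\<forall>e. P e \<longleftrightarrow> (\<exists>e'. (\<forall>i<k. e' i = e i) \<and> (\<forall>\<psi> \<in> set \<psi>s. sat_atomic \<Gamma> e' \<psi>))))"

lemma pp_predI:
  assumes "\<And>e. P e \<longleftrightarrow> (\<exists>e'. (\<forall>i<k. e' i = e i) \<and> (\<forall>\<psi> \<in> set \<psi>s. sat_atomic \<Gamma> e' \<psi>))"
    and "\<forall>\<psi> \<in> set \<psi>s. wf_atomic \<Gamma> \<psi> \<and> vars_atomic \<psi> \<subseteq> {..<k + n}"
  shows "pp_pred \<Gamma> k P"
  unfolding pp_pred_def using assms by (intro exI[of _ n] exI[of _ \<psi>s]) simp

lemma pp_definable_if_pp_pred: "pp_pred \<Gamma> k P \<Longrightarrow> pp_definable \<Gamma> k (defined_rel k P)"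
  unfolding pp_pred_def pp_definable_def defined_rel_def by (elim ex_forward) auto

lemma pp_pred_local:
  assumes "pp_pred \<Gamma> k P" "\<And>i. i < k \<Longrightarrow> e i = e' i"
  shows "P e = P e'"
proof -
  have "(\<forall>i<k. f i = e i) \<longleftrightarrow> (\<forall>i<k. f i = e' i)" for f using assms(2) by auto
  then show ?thesis using assms(1) unfolding pp_pred_def by auto
qed

fun rename_atomic :: "(nat \<Rightarrow> nat) \<Rightarrow> 's atomic \<Rightarrow> 's atomic" where
  "rename_atomic f (Eq x y) = Eq (f x) (f y)"
| "rename_atomic f (Rel r xs) = Rel r (map f xs)"

lemma wf_rename_atomic [simp]: "wf_atomic \<Gamma> (rename_atomic f \<psi>) = wf_atomic \<Gamma> \<psi>"
  by (cases \<psi>) auto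

lemma vars_rename_atomic [simp]: "vars_atomic (rename_atomic f \<psi>) = f ` vars_atomic \<psi>"
  by (cases \<psi>) auto

lemma sat_rename_atomic [simp]: "sat_atomic \<Gamma> e (rename_atomic f \<psi>) = sat_atomic \<Gamma> (e \<circ> f) \<psi>"
  by (cases \<psi>) auto

lemma sat_atomic_cong:
  "(\<And>i. i \<in> vars_atomic \<psi> \<Longrightarrow> e i = e' i) \<Longrightarrow> sat_atomic \<Gamma> e \<psi> = sat_atomic \<Gamma> e' \<psi>"
  by (cases \<psi>) (auto cong: map_cong)

text \<open>No injectivity is asked of \<open>\<sigma>\<close>, so identifying variables and adding
  dummy variables are covered. Bound variables move behind the m new free ones; an assignment can be
  pulled back along \<open>f\<close> because it already agrees with \<open>\<sigma>\<close> on the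
  free variables.\<close>

lemma pp_pred_rename:
  assumes "pp_pred \<Gamma> k P" and \<sigma>: "\<And>i. i < k \<Longrightarrow> \<sigma> i < m"
  shows "pp_pred \<Gamma> m (\<lambda>e. P (\<lambda>i. e (\<sigma> i)))"
proof -
  obtain n \<psi>s where \<psi>s: "\<forall>\<psi>\<in>set \<psi>s. wf_atomic \<Gamma> \<psi> \<and> vars_atomic \<psi> \<subseteq> {..<k + n}"
    and P: "\<And>e. P e \<longleftrightarrow> (\<exists>e'. (\<forall>i<k. e' i = e i) \<and> (\<forall>\<psi>\<in>set \<psi>s. sat_atomic \<Gamma> e' \<psi>))"
    using assms(1) unfolding pp_pred_def by metis
  define f where "f i = (if i < k then \<sigma> i else i - k + m)" for i
  have "P (\<lambda>i. e (\<sigma> i)) \<longleftrightarrow>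
    (\<exists>e'. (\<forall>i<m. e' i = e i) \<and> (\<forall>\<psi>\<in>set (map (rename_atomic f) \<psi>s). sat_atomic \<Gamma> e' \<psi>))" for e
  proof
    assume "P (\<lambda>i. e (\<sigma> i))"
    then obtain e' where e': "\<forall>i<k. e' i = e (\<sigma> i)" "\<forall>\<psi>\<in>set \<psi>s. sat_atomic \<Gamma> e' \<psi>"
      by (auto simp: P)
    define g where "g i = (if i < m then e i else e' (i - m + k))" for i
    have "g \<circ> f = e'" using e'(1) \<sigma> by (auto simp: g_def f_def fun_eq_iff)
    then show "\<exists>e'. (\<forall>i<m. e' i = e i) \<and>
        (\<forall>\<psi>\<in>set (map (rename_atomic f) \<psi>s). sat_atomic \<Gamma> e' \<psi>)"
      using e'(2) by (intro exI[of _ g]) (auto simp: g_def)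
  next
    assume "\<exists>e'. (\<forall>i<m. e' i = e i) \<and>
        (\<forall>\<psi>\<in>set (map (rename_atomic f) \<psi>s). sat_atomic \<Gamma> e' \<psi>)"
    then obtain g where "\<forall>i<m. g i = e i" "\<forall>\<psi>\<in>set \<psi>s. sat_atomic \<Gamma> (g \<circ> f) \<psi>" by auto
    then show "P (\<lambda>i. e (\<sigma> i))"
      unfolding P using \<sigma> by (intro exI[of _ "g \<circ> f"]) (auto simp: f_def)
  qed
  moreover have "\<forall>\<psi>\<in>set (map (rename_atomic f) \<psi>s). wf_atomic \<Gamma> \<psi> \<and> vars_atomic \<psi> \<subseteq> {..<m + n}"
  proof -
    have "f i < m + n" if "i < k + n" for i using that \<sigma>[of i] by (auto simp: f_def)
    then have "f ` vars_atomic \<psi> \<subseteq> {..<m + n}" if "\<psi> \<in> set \<psi>s" for \<psi>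
      using \<psi>s that by (auto dest!: bspec)
    then show ?thesis using \<psi>s by simp
  qed
  ultimately show ?thesis by (rule pp_predI)
qed

lemma pp_pred_conj:
  assumes "pp_pred \<Gamma> k P" "pp_pred \<Gamma> k Q"
  shows "pp_pred \<Gamma> k (\<lambda>e. P e \<and> Q e)"
proof -
  obtain n \<psi>s where \<psi>s: "\<forall>\<psi>\<in>set \<psi>s. wf_atomic \<Gamma> \<psi> \<and> vars_atomic \<psi> \<subseteq> {..<k + n}"
    and P: "\<And>e. P e \<longleftrightarrow> (\<exists>e'. (\<forall>i<k. e' i = e i) \<and> (\<forall>\<psi>\<in>set \<psi>s. sat_atomic \<Gamma> e' \<psi>))"
    using assms(1) unfolding pp_pred_def by metis
  obtain m \<chi>s where \<chi>s: "\<forall>\<psi>\<in>set \<chi>s. wf_atomic \<Gamma> \<psi> \<and> vars_atomic \<psi> \<subseteq> {..<k + m}"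
    and Q: "\<And>e. Q e \<longleftrightarrow> (\<exists>e'. (\<forall>i<k. e' i = e i) \<and> (\<forall>\<psi>\<in>set \<chi>s. sat_atomic \<Gamma> e' \<psi>))"
    using assms(2) unfolding pp_pred_def by metis
  \<comment> \<open>The bound variables of the second formula are shifted by n, behind those of the
    first, so that both can be witnessed by one assignment.\<close>
  define f where "f i = (if i < k then i else i + n)" for i
  define \<theta>s where "\<theta>s = \<psi>s @ map (rename_atomic f) \<chi>s"
  have "P e \<and> Q e \<longleftrightarrow> (\<exists>e'. (\<forall>i<k. e' i = e i) \<and> (\<forall>\<psi>\<in>set \<theta>s. sat_atomic \<Gamma> e' \<psi>))" for e
  proof
    assume "P e \<and> Q e"
    then obtain e1 e2 where e1: "\<forall>i<k. e1 i = e i" "\<forall>\<psi>\<in>set \<psi>s. sat_atomic \<Gamma> e1 \<psi>"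
      and e2: "\<forall>i<k. e2 i = e i" "\<forall>\<psi>\<in>set \<chi>s. sat_atomic \<Gamma> e2 \<psi>"
      by (auto simp: P Q)
    define g where "g i = (if i < k + n then e1 i else e2 (i - n))" for i
    have "g \<circ> f = e2" using e1(1) e2(1) by (auto simp: g_def f_def fun_eq_iff)
    moreover have "sat_atomic \<Gamma> g \<psi> = sat_atomic \<Gamma> e1 \<psi>" if "\<psi> \<in> set \<psi>s" for \<psi>
      by (rule sat_atomic_cong) (use \<psi>s that in \<open>auto simp: g_def\<close>)
    ultimately show "\<exists>e'. (\<forall>i<k. e' i = e i) \<and> (\<forall>\<psi>\<in>set \<theta>s. sat_atomic \<Gamma> e' \<psi>)"
      using e1 e2 by (intro exI[of _ g]) (auto simp: g_def \<theta>s_def)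
  next
    assume "\<exists>e'. (\<forall>i<k. e' i = e i) \<and> (\<forall>\<psi>\<in>set \<theta>s. sat_atomic \<Gamma> e' \<psi>)"
    then obtain g where g: "\<forall>i<k. g i = e i" "\<forall>\<psi>\<in>set \<psi>s. sat_atomic \<Gamma> g \<psi>"
      "\<forall>\<psi>\<in>set \<chi>s. sat_atomic \<Gamma> (g \<circ> f) \<psi>"
      by (auto simp: \<theta>s_def ball_Un)
    moreover have "\<forall>i<k. (g \<circ> f) i = e i" using g by (simp add: f_def)
    ultimately show "P e \<and> Q e" unfolding P Q by blast
  qed
  moreover have "\<forall>\<psi>\<in>set \<theta>s. wf_atomic \<Gamma> \<psi> \<and> vars_atomic \<psi> \<subseteq> {..<k + (n + m)}"
  proof -
    have "f i < k + (n + m)" if "i < k + m" for i using that by (auto simp: f_def)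
    then have "f ` vars_atomic \<psi> \<subseteq> {..<k + (n + m)}" if "\<psi> \<in> set \<chi>s" for \<psi>
      using \<chi>s that by (auto dest!: bspec)
    moreover have "vars_atomic \<psi> \<subseteq> {..<k + (n + m)}" if "\<psi> \<in> set \<psi>s" for \<psi>
      using \<psi>s that by (auto dest!: bspec)
    ultimately show ?thesis using \<psi>s \<chi>s by (simp add: \<theta>s_def ball_Un)
  qed
  ultimately show ?thesis by (rule pp_predI)
qed

lemma pp_pred_True: "pp_pred \<Gamma> k (\<lambda>e. True)"
  unfolding pp_pred_def by (intro exI[of _ 0] exI[of _ "[]"]) auto

lemma pp_pred_ball:
  "finite I \<Longrightarrow> (\<And>i. i \<in> I \<Longrightarrow> pp_pred \<Gamma> k (Q i)) \<Longrightarrow> pp_pred \<Gamma> k (\<lambda>e. \<forall>i\<in>I. Q i e)"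
  by (induction I rule: finite_induct) (simp_all add: pp_pred_True pp_pred_conj)

lemma pp_pred_ex:
  assumes "pp_pred \<Gamma> (k + m) P"
  shows "pp_pred \<Gamma> k (\<lambda>e. \<exists>e'. (\<forall>i<k. e' i = e i) \<and> P e')"
proof -
  obtain n \<psi>s where \<psi>s: "\<forall>\<psi>\<in>set \<psi>s. wf_atomic \<Gamma> \<psi> \<and> vars_atomic \<psi> \<subseteq> {..<k + m + n}"
    and P: "\<And>e. P e \<longleftrightarrow> (\<exists>e'. (\<forall>i<k + m. e' i = e i) \<and> (\<forall>\<psi>\<in>set \<psi>s. sat_atomic \<Gamma> e' \<psi>))"
    using assms unfolding pp_pred_def by metis
  have "(\<exists>e'. (\<forall>i<k. e' i = e i) \<and> P e') \<longleftrightarrow>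
      (\<exists>e'. (\<forall>i<k. e' i = e i) \<and> (\<forall>\<psi>\<in>set \<psi>s. sat_atomic \<Gamma> e' \<psi>))" for e
  proof
    assume "\<exists>e'. (\<forall>i<k. e' i = e i) \<and> P e'"
    then obtain e1 e2 where "\<forall>i<k. e1 i = e i" "\<forall>i<k + m. e2 i = e1 i"
      "\<forall>\<psi>\<in>set \<psi>s. sat_atomic \<Gamma> e2 \<psi>"
      by (auto simp: P)
    then show "\<exists>e'. (\<forall>i<k. e' i = e i) \<and> (\<forall>\<psi>\<in>set \<psi>s. sat_atomic \<Gamma> e' \<psi>)"
      by (intro exI[of _ e2]) auto
  next
    assume "\<exists>e'. (\<forall>i<k. e' i = e i) \<and> (\<forall>\<psi>\<in>set \<psi>s. sat_atomic \<Gamma> e' \<psi>)"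
    then show "\<exists>e'. (\<forall>i<k. e' i = e i) \<and> P e'" unfolding P by blast
  qed
  then show ?thesis
    unfolding pp_pred_def using \<psi>s
    by (intro exI[of _ "m + n"] exI[of _ \<psi>s]) (simp add: add.assoc)
qed

lemma pp_pred_atomic:
  "wf_atomic \<Gamma> \<psi> \<Longrightarrow> vars_atomic \<psi> \<subseteq> {..<k} \<Longrightarrow> pp_pred \<Gamma> k (\<lambda>e. sat_atomic \<Gamma> e \<psi>)"
  unfolding pp_pred_def
  by (intro exI[of _ 0] exI[of _ "[\<psi>]"]) (auto intro: sat_atomic_cong[THEN iffD1, rotated])

section \<open>Functions with primitive positive graph\<close>

text \<open>These play the role of terms; variable k holds the value. Locality is a separate demand,
  since the graph condition alone would let L depend on the value variable itself:
  \<open>L e = e k\<close> has a trivially true graph.\<close>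

definition pp_fun :: "('s, 'a) rel_structure \<Rightarrow> nat \<Rightarrow> ((nat \<Rightarrow> 'a) \<Rightarrow> 'a) \<Rightarrow> bool" where
  "pp_fun \<Gamma> k L \<longleftrightarrow>
     (\<forall>e e'. (\<forall>i<k. e i = e' i) \<longrightarrow> L e = L e') \<and> pp_pred \<Gamma> (Suc k) (\<lambda>e. e k = L e)"

lemma pp_fun_cong: "pp_fun \<Gamma> k L \<Longrightarrow> (\<And>i. i < k \<Longrightarrow> e i = e' i) \<Longrightarrow> L e = L e'"
  unfolding pp_fun_def by blast

lemma pp_fun_graph:
  assumes "pp_fun \<Gamma> k L" "k \<le> m" "j < m"
  shows "pp_pred \<Gamma> m (\<lambda>e. e j = L e)"
proof -
  define \<sigma> where "\<sigma> i = (if i < k then i else j)" for i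
  have "pp_pred \<Gamma> m (\<lambda>e. e (\<sigma> k) = L (\<lambda>i. e (\<sigma> i)))"
    by (rule pp_pred_rename[of \<Gamma> "Suc k" "\<lambda>e. e k = L e"])
      (use assms in \<open>auto simp: pp_fun_def \<sigma>_def\<close>)
  moreover have "L (\<lambda>i. e (\<sigma> i)) = L e" for e
    by (rule pp_fun_cong[OF assms(1)]) (simp add: \<sigma>_def)
  ultimately show ?thesis by (simp add: \<sigma>_def)
qed

lemma pp_fun_mono: "pp_fun \<Gamma> k L \<Longrightarrow> k \<le> m \<Longrightarrow> pp_fun \<Gamma> m L"
  using pp_fun_graph[of \<Gamma> k L "Suc m" m] unfolding pp_fun_def by auto

lemma pp_fun_var: "i < k \<Longrightarrow> pp_fun \<Gamma> k (\<lambda>e. e i)"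
  unfolding pp_fun_def using pp_pred_atomic[of \<Gamma> "Eq k i" "Suc k"] by auto

text \<open>The bound variable \<open>k + i\<close> receives the value \<open>L i e\<close>. Graphs
  determine these values uniquely, so quantifying existentially over them amounts to
  substitution.\<close>

lemma pp_pred_subst:
  assumes P: "pp_pred \<Gamma> m P" and L: "\<And>i. i < m \<Longrightarrow> pp_fun \<Gamma> k (L i)"
  shows "pp_pred \<Gamma> k (\<lambda>e. P (\<lambda>i. L i e))"
proof -
  have "pp_pred \<Gamma> (k + m) (\<lambda>e. (\<forall>i\<in>{..<m}. e (k + i) = L i e) \<and> P (\<lambda>i. e (k + i)))"
    using L by (intro pp_pred_conj pp_pred_ball pp_pred_rename[OF P]) (auto intro!: pp_fun_graph[of \<Gamma> k])
  from pp_pred_ex[OF this]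
  have "pp_pred \<Gamma> k (\<lambda>e. \<exists>e'. (\<forall>i<k. e' i = e i) \<and>
      (\<forall>i\<in>{..<m}. e' (k + i) = L i e') \<and> P (\<lambda>i. e' (k + i)))" .
  moreover have "(\<exists>e'. (\<forall>i<k. e' i = e i) \<and>
      (\<forall>i\<in>{..<m}. e' (k + i) = L i e') \<and> P (\<lambda>i. e' (k + i))) \<longleftrightarrow> P (\<lambda>i. L i e)" for e
  proof
    assume "\<exists>e'. (\<forall>i<k. e' i = e i) \<and> (\<forall>i\<in>{..<m}. e' (k + i) = L i e') \<and> P (\<lambda>i. e' (k + i))"
    then obtain e' where e': "\<forall>i<k. e' i = e i" "\<forall>i<m. e' (k + i) = L i e'"
      "P (\<lambda>i. e' (k + i))" by auto
    have "L i e' = L i e" if "i < m" for i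
      by (rule pp_fun_cong[OF L[OF that]]) (simp add: e'(1))
    then have "P (\<lambda>i. e' (k + i)) = P (\<lambda>i. L i e)"
      using e'(2) by (intro pp_pred_local[OF P]) auto
    then show "P (\<lambda>i. L i e)" using e'(3) by simp
  next
    assume PL: "P (\<lambda>i. L i e)"
    define e' where "e' i = (if i < k then e i else L (i - k) e)" for i
    have "L i e' = L i e" if "i < m" for i
      by (rule pp_fun_cong[OF L[OF that]]) (simp add: e'_def)
    then show "\<exists>e'. (\<forall>i<k. e' i = e i) \<and> (\<forall>i\<in>{..<m}. e' (k + i) = L i e') \<and> P (\<lambda>i. e' (k + i))"
      using PL by (intro exI[of _ e']) (auto simp: e'_def)
  qed
  ultimately show ?thesis by simp
qed

lemma pp_pred_subst2:
  assumes "pp_pred \<Gamma> 2 (\<lambda>e. Q (e 0) (e 1))" "pp_fun \<Gamma> k L" "pp_fun \<Gamma> k M"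
  shows "pp_pred \<Gamma> k (\<lambda>e. Q (L e) (M e))"
  using pp_pred_subst[OF assms(1), of k "\<lambda>i. if i = 0 then L else M"] assms by simp

lemma pp_pred_subst3:
  assumes "pp_pred \<Gamma> 3 (\<lambda>e. Q (e 0) (e 1) (e 2))" "pp_fun \<Gamma> k L" "pp_fun \<Gamma> k M" "pp_fun \<Gamma> k N"
  shows "pp_pred \<Gamma> k (\<lambda>e. Q (L e) (M e) (N e))"
  using pp_pred_subst[OF assms(1), of k "\<lambda>i. if i = 0 then L else if i = 1 then M else N"] assms
  by simp

lemma pp_pred_ex1:
  assumes "pp_pred \<Gamma> (Suc k) (\<lambda>e. Q e (e k))" "\<And>e e' a. (\<And>i. i < k \<Longrightarrow> e i = e' i) \<Longrightarrow> Q e a = Q e' a"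
  shows "pp_pred \<Gamma> k (\<lambda>e. \<exists>a. Q e a)"
proof -
  have "(\<exists>e'. (\<forall>i<k. e' i = e i) \<and> Q e' (e' k)) \<longleftrightarrow> (\<exists>a. Q e a)" for e
  proof
    assume "\<exists>e'. (\<forall>i<k. e' i = e i) \<and> Q e' (e' k)"
    then show "\<exists>a. Q e a" using assms(2) by metis
  next
    assume "\<exists>a. Q e a"
    then obtain a where "Q e a" ..
    then have "Q (e(k := a)) a" using assms(2)[of "e(k := a)" e] by simp
    then show "\<exists>e'. (\<forall>i<k. e' i = e i) \<and> Q e' (e' k)" by (intro exI[of _ "e(k := a)"]) simp
  qed
  then show ?thesis using pp_pred_ex[of \<Gamma> k 1 "\<lambda>e. Q e (e k)"] assms(1) by simp
qed

section \<open>Rational linear combinations from addition\<close>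

locale pp_plus =
  fixes \<Gamma> :: "('s, rat) rel_structure"
  assumes plus: "pp_pred \<Gamma> 3 (\<lambda>e. e 0 + e 1 = e 2)"
begin

lemma pp_fun_zero: "pp_fun \<Gamma> k (\<lambda>e. 0)"
proof -
  \<comment> \<open>Zero is the only idempotent of addition.\<close>
  have "pp_pred \<Gamma> (Suc k) (\<lambda>e. e k + e k = e k)"
    by (intro pp_pred_subst3[OF plus] pp_fun_var) auto
  then show ?thesis by (simp add: pp_fun_def)
qed

lemma pp_fun_add:
  assumes "pp_fun \<Gamma> k L" "pp_fun \<Gamma> k M"
  shows "pp_fun \<Gamma> k (\<lambda>e. L e + M e)"
proof -
  have "pp_pred \<Gamma> (Suc k) (\<lambda>e. L e + M e = e k)"
    using assms by (intro pp_pred_subst3[OF plus] pp_fun_var) (auto intro: pp_fun_mono)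
  moreover have "L e + M e = L e' + M e'" if "\<forall>i<k. e i = e' i" for e e'
    using that assms by (metis pp_fun_cong)
  ultimately show ?thesis by (auto simp: pp_fun_def eq_commute)
qed

lemma pp_fun_diff:
  assumes "pp_fun \<Gamma> k L" "pp_fun \<Gamma> k M"
  shows "pp_fun \<Gamma> k (\<lambda>e. L e - M e)"
proof -
  have "pp_pred \<Gamma> (Suc k) (\<lambda>e. e k + M e = L e)"
    using assms by (intro pp_pred_subst3[OF plus] pp_fun_var) (auto intro: pp_fun_mono)
  moreover have "L e - M e = L e' - M e'" if "\<forall>i<k. e i = e' i" for e e'
    using that assms by (metis pp_fun_cong)
  ultimately show ?thesis by (auto simp: pp_fun_def eq_diff_eq)
qed

lemma pp_fun_of_nat_mult: "pp_fun \<Gamma> k L \<Longrightarrow> pp_fun \<Gamma> k (\<lambda>e. of_nat n * L e)"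
proof (induction n)
  case (Suc n)
  then have "pp_fun \<Gamma> k (\<lambda>e. L e + of_nat n * L e)" by (intro pp_fun_add)
  then show ?case by (simp add: algebra_simps)
qed (simp add: pp_fun_zero)

lemma pp_fun_of_int_mult: "pp_fun \<Gamma> k L \<Longrightarrow> pp_fun \<Gamma> k (\<lambda>e. of_int n * L e)"
  using pp_fun_of_nat_mult[of k L "nat n"]
    pp_fun_diff[OF pp_fun_zero, OF pp_fun_of_nat_mult[of k L "nat (- n)"]]
  by (cases "n \<ge> 0") simp_all

lemma pp_fun_mult:
  assumes "pp_fun \<Gamma> k L"
  shows "pp_fun \<Gamma> k (\<lambda>e. q * L e)"
proof -
  obtain a b where q: "q = of_int a / of_int b" "b > 0"
    by (metis quotient_of_denom_pos' quotient_of_div surjective_pairing)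
  \<comment> \<open>Division by b is solving \<open>b * y = a * L e\<close> for y, which is unique
    because b is positive. The summand 0 brings the equation into the ternary form of
    \<open>plus\<close>.\<close>
  have "pp_pred \<Gamma> (Suc k) (\<lambda>e. 0 + of_int b * e k = of_int a * L e)"
    using assms
    by (intro pp_pred_subst3[OF plus] pp_fun_zero pp_fun_of_int_mult pp_fun_var) (auto intro: pp_fun_mono)
  moreover have "0 + of_int b * e k = of_int a * L e \<longleftrightarrow> e k = q * L e" for e
    using q(2) unfolding q(1) by (auto simp: field_simps)
  moreover have "q * L e = q * L e'" if "\<forall>i<k. e i = e' i" for e e'
    using that assms by (metis pp_fun_cong)
  ultimately show ?thesis by (auto simp: pp_fun_def)
qed

lemma pp_fun_lin: "finite V \<Longrightarrow> V \<subseteq> {..<k} \<Longrightarrow> pp_fun \<Gamma> k (lin V c)"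
  unfolding lin_def[abs_def]
  by (induction V rule: finite_induct) (auto intro!: pp_fun_zero pp_fun_add pp_fun_mult pp_fun_var)

end

section \<open>Linear equations as equations between sums of variables\<close>

lemma ex_term_add_mult:
  assumes "vars_term t \<subseteq> V" "i \<in> V"
  shows "\<exists>t'. vars_term t' \<subseteq> V \<and> (\<forall>e. eval_term e t' = eval_term e t + of_nat n * e i)"
proof (induction n)
  case 0
  show ?case using assms by (intro exI[of _ t]) simp
next
  case (Suc n)
  then obtain t' where "vars_term t' \<subseteq> V" "\<forall>e. eval_term e t' = eval_term e t + of_nat n * e i"
    by blast
  then show ?case using assms by (intro exI[of _ "Plus t' (Var i)"]) (simp add: algebra_simps)
qed

lemma ex_term_nat_coeffs:
  assumes "j \<in> V" "finite W" "W \<subseteq> V"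
  shows "\<exists>t. vars_term t \<subseteq> V \<and> (\<forall>e. eval_term e t = e j + (\<Sum>i\<in>W. of_nat (p i) * e i))"
  using assms(2,3)
proof (induction W rule: finite_induct)
  case empty
  show ?case using assms(1) by (intro exI[of _ "Var j"]) simp
next
  case (insert x W)
  then obtain t where t: "vars_term t \<subseteq> V"
    "\<forall>e. eval_term e t = e j + (\<Sum>i\<in>W. of_nat (p i) * e i)"
    by auto
  obtain t' where "vars_term t' \<subseteq> V" "\<forall>e. eval_term e t' = eval_term e t + of_nat (p x) * e x"
    using ex_term_add_mult[OF t(1), of x "p x"] insert by auto
  then show ?case using t insert by (intro exI[of _ t']) (simp add: algebra_simps)
qed

lemma ex_common_denominator:
  fixes c :: "nat \<Rightarrow> rat"
  assumes "finite V"
  shows "\<exists>N z. N \<noteq> 0 \<and> (\<forall>i\<in>V. N * c i = of_int (z i))"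
proof -
  define a b where "a i = fst (quotient_of (c i))" and "b i = snd (quotient_of (c i))" for i
  have b: "b i \<noteq> 0" for i using quotient_of_denom_pos'[of "c i"] by (simp add: b_def)
  have c: "c i = of_int (a i) / of_int (b i)" for i
    by (rule quotient_of_div) (simp add: a_def b_def)
  have "of_int (\<Prod>j\<in>V. b j) * c i = of_int ((\<Prod>j\<in>V - {i}. b j) * a i)" if "i \<in> V" for i
    using that assms b[of i] by (simp add: c prod.remove[of V i b])
  then show ?thesis
    using b assms
    by (intro exI[of _ "of_int (\<Prod>j\<in>V. b j)"] exI[of _ "\<lambda>i. (\<Prod>j\<in>V - {i}. b j) * a i"])
      (simp only: of_int_eq_0_iff, simp)
qed

text \<open>A term is never empty, so both sides carry the extra summand \<open>e j\<close>.\<close>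

lemma ex_terms_lin:
  assumes "finite V" "j \<in> V"
  shows "\<exists>s t. vars_term s \<subseteq> V \<and> vars_term t \<subseteq> V \<and>
    (\<forall>e. eval_term e s = eval_term e t \<longleftrightarrow> lin V c e = 0)"
proof -
  obtain N z where N: "N \<noteq> 0" "\<forall>i\<in>V. N * c i = of_int (z i)"
    using ex_common_denominator[OF assms(1)] by blast
  \<comment> \<open>There is no subtraction in terms: the positive parts of the integer coefficients
    go to one side of the equation and the negative parts to the other.\<close>
  obtain s where s: "vars_term s \<subseteq> V"
    "\<forall>e. eval_term e s = e j + (\<Sum>i\<in>V. of_nat (nat (z i)) * e i)"
    using ex_term_nat_coeffs[OF assms(2,1), of "\<lambda>i. nat (z i)"] by auto
  obtain t where t: "vars_term t \<subseteq> V"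
    "\<forall>e. eval_term e t = e j + (\<Sum>i\<in>V. of_nat (nat (- z i)) * e i)"
    using ex_term_nat_coeffs[OF assms(2,1), of "\<lambda>i. nat (- z i)"] by auto
  have "eval_term e s - eval_term e t = N * lin V c e" for e
  proof -
    have "eval_term e s - eval_term e t
        = (\<Sum>i\<in>V. of_nat (nat (z i)) * e i - of_nat (nat (- z i)) * e i)"
      by (simp add: s t sum_subtractf)
    also have "\<dots> = (\<Sum>i\<in>V. N * (c i * e i))"
    proof (rule sum.cong)
      fix i assume "i \<in> V"
      then have "N * (c i * e i) = of_int (z i) * e i" using N(2) by (simp flip: mult.assoc)
      then show "of_nat (nat (z i)) * e i - of_nat (nat (- z i)) * e i = N * (c i * e i)"
        by (cases "z i \<ge> 0") auto
    qed simp
    finally show ?thesis by (simp add: lin_def sum_distrib_left)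
  qed
  then have "eval_term e s = eval_term e t \<longleftrightarrow> lin V c e = 0" for e
    using N(1) by (metis eq_iff_diff_eq_0 mult_eq_0_iff)
  then show ?thesis using s(1) t(1) by blast
qed

section \<open>Horn definitions from closure under intersection\<close>

text \<open>
  The zero set \<open>zeros {..<k} F e\<^sub>0\<close> of a non-solution is excluded by the clause that says: if all its
  forms vanish, then so does some further form that vanishes at every solution where they do.
\<close>

lemma ex_horn_clause:
  assumes k: "k > 0" and F: "determined_by {..<k} F P" and e0: "\<not> P e0"
    and inter: "\<And>a b. P a \<Longrightarrow> P b \<Longrightarrow> \<exists>d. P d \<and> zeros {..<k} F d = zeros {..<k} F a \<inter> zeros {..<k} F b"
  shows "\<exists>cl. (\<forall>l\<in>set cl. vars_literal l \<subseteq> {..<k}) \<and> length (filter is_positive cl) \<le> 1 \<and>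
    (\<forall>e. P e \<longrightarrow> (\<exists>l\<in>set cl. sat_literal e l)) \<and>
    (\<forall>e. zeros {..<k} F e = zeros {..<k} F e0 \<longrightarrow> \<not> (\<exists>l\<in>set cl. sat_literal e l))"
proof -
  define z where "z = zeros {..<k} F"
  have finF: "finite F" using F by (simp add: determined_by_def)
  have zF: "z e \<subseteq> F" for e by (auto simp: z_def zeros_def)
  have zmem: "c \<in> z e \<longleftrightarrow> c \<in> F \<and> lin {..<k} c e = 0" for c e by (auto simp: z_def zeros_def)
  \<comment> \<open>Every term contains a variable, which is where k > 0 enters.\<close>
  have "\<forall>c. \<exists>s t. vars_term s \<subseteq> {..<k} \<and> vars_term t \<subseteq> {..<k} \<and>
      (\<forall>e. eval_term e s = eval_term e t \<longleftrightarrow> lin {..<k} c e = 0)"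
    using ex_terms_lin[of "{..<k}" 0] k by auto
  then obtain s t where st: "\<And>c. vars_term (s c) \<subseteq> {..<k}" "\<And>c. vars_term (t c) \<subseteq> {..<k}"
    "\<And>c e. eval_term e (s c) = eval_term e (t c) \<longleftrightarrow> lin {..<k} c e = 0"
    by metis
  obtain cs where cs: "set cs = z e0"
    using finite_list[of "z e0"] finite_subset[OF zF finF] by blast
  define neg where "neg = map (\<lambda>c. NegEq (s c) (t c)) cs"
  have neg_filter: "filter is_positive neg = []" by (simp add: neg_def filter_empty_conv)
  have neg_vars: "\<forall>l\<in>set neg. vars_literal l \<subseteq> {..<k}" using st by (auto simp: neg_def)
  have neg_sat: "(\<exists>l\<in>set neg. sat_literal e l) \<longleftrightarrow> \<not> z e0 \<subseteq> z e" for e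
    using zF[of e0] by (auto simp: neg_def cs st(3) zmem)
  show ?thesis
  proof (cases "\<exists>a. P a \<and> z e0 \<subseteq> z a")
    \<comment> \<open>No solution has all the zeros of e0, so the negative literals alone are a
      valid clause.\<close>
    case False
    then have "\<forall>e. P e \<longrightarrow> (\<exists>l\<in>set neg. sat_literal e l)" unfolding neg_sat by blast
    moreover have "\<forall>e. z e = z e0 \<longrightarrow> \<not> (\<exists>l\<in>set neg. sat_literal e l)" unfolding neg_sat by blast
    ultimately show ?thesis using neg_filter neg_vars by (intro exI[of _ neg]) (simp add: z_def)
  next
    case True
    \<comment> \<open>Among the solutions whose zeros include those of e0, one with the fewest
      zeros. Closure under intersection makes its zero set the least one, not merely a minimal
      one.\<close>
    then obtain b where b: "P b" "z e0 \<subseteq> z b"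
      and b_min: "\<And>a. P a \<Longrightarrow> z e0 \<subseteq> z a \<Longrightarrow> card (z b) \<le> card (z a)"
      using ex_has_least_nat[of "\<lambda>a. P a \<and> z e0 \<subseteq> z a" _ "\<lambda>a. card (z a)"] by metis
    have b_least: "z b \<subseteq> z a" if a: "P a" "z e0 \<subseteq> z a" for a
    proof -
      obtain d where d: "P d" "z d = z a \<inter> z b" using inter[OF a(1) b(1)] unfolding z_def by blast
      then have "card (z b) \<le> card (z d)" using a b by (intro b_min) auto
      moreover have "finite (z b)" using finite_subset[OF zF finF] .
      ultimately have "z d = z b" using d(2) by (intro card_seteq) auto
      then show ?thesis using d(2) by blast
    qed
    have "z b \<noteq> z e0" using determined_byD[OF F, of b e0] b(1) e0 by (auto simp: z_def)
    then obtain d where d: "d \<in> z b" "d \<notin> z e0" using b(2) by blast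
    define cl where "cl = PosEq (s d) (t d) # neg"
    have dF: "d \<in> F" using d(1) zF by blast
    have cl_sat: "(\<exists>l\<in>set cl. sat_literal e l) \<longleftrightarrow> d \<in> z e \<or> \<not> z e0 \<subseteq> z e" for e
      using dF by (simp add: cl_def neg_sat st(3) zmem)
    have "\<forall>e. P e \<longrightarrow> (\<exists>l\<in>set cl. sat_literal e l)" unfolding cl_sat using b_least d(1) by blast
    moreover have "\<forall>e. z e = z e0 \<longrightarrow> \<not> (\<exists>l\<in>set cl. sat_literal e l)"
      unfolding cl_sat using d(2) by blast
    ultimately show ?thesis
      using neg_filter neg_vars st by (intro exI[of _ cl]) (simp add: z_def cl_def)
  qed
qed

text \<open>One clause is taken for each zero set of a non-solution. All of these are subsets of the
  finite F, so the conjunction is finite.\<close>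

lemma qf_horn_definable_if_zeros_inter_closed:
  assumes F: "determined_by {..<k} F P"
    and inter: "\<And>a b. P a \<Longrightarrow> P b \<Longrightarrow> \<exists>d. P d \<and> zeros {..<k} F d = zeros {..<k} F a \<inter> zeros {..<k} F b"
  shows "qf_horn_definable_Q_plus k (defined_rel k P)"
proof (cases "k = 0")
  case True
  \<comment> \<open>Without variables there are no literals: what remains is the empty conjunction,
    which is true, and the single empty clause, which is false.\<close>
  define cs :: cnf where "cs = (if \<exists>e. P e then [] else [[]])"
  have "defined_rel k P = defined_rel k (\<lambda>e. sat_cnf e cs)"
    by (auto simp: True cs_def defined_rel_def sat_cnf_def)
  then show ?thesis
    unfolding qf_horn_definable_Q_plus_def
    by (intro exI[of _ cs]) (auto simp: cs_def horn_cnf_def)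
next
  case False
  define z where "z = zeros {..<k} F"
  define \<Z> where "\<Z> = z ` {e. \<not> P e}"
  have "\<Z> \<subseteq> Pow F" by (auto simp: \<Z>_def z_def zeros_def)
  then have "finite \<Z>" using F by (auto simp: determined_by_def intro: finite_subset)
  then obtain Zs where Zs: "set Zs = \<Z>" using finite_list by blast
  define good where "good Z cl \<longleftrightarrow>
    (\<forall>l\<in>set cl. vars_literal l \<subseteq> {..<k}) \<and> length (filter is_positive cl) \<le> 1 \<and>
    (\<forall>e. P e \<longrightarrow> (\<exists>l\<in>set cl. sat_literal e l)) \<and>
    (\<forall>e. z e = Z \<longrightarrow> \<not> (\<exists>l\<in>set cl. sat_literal e l))" for Z cl
  have "\<forall>Z\<in>\<Z>. \<exists>cl. good Z cl"
    using ex_horn_clause[OF _ F _ inter] False by (auto simp: \<Z>_def z_def good_def)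
  then obtain cl where "\<forall>Z\<in>\<Z>. good Z (cl Z)" using bchoice by blast
  then have cl: "\<And>Z l. Z \<in> \<Z> \<Longrightarrow> l \<in> set (cl Z) \<Longrightarrow> vars_literal l \<subseteq> {..<k}"
    "\<And>Z. Z \<in> \<Z> \<Longrightarrow> length (filter is_positive (cl Z)) \<le> 1"
    "\<And>Z e. Z \<in> \<Z> \<Longrightarrow> P e \<Longrightarrow> \<exists>l\<in>set (cl Z). sat_literal e l"
    "\<And>e. z e \<in> \<Z> \<Longrightarrow> \<not> (\<exists>l\<in>set (cl (z e)). sat_literal e l)"
    unfolding good_def by blast+
  have "P e \<longleftrightarrow> sat_cnf e (map cl Zs)" for e
  proof
    show "P e \<Longrightarrow> sat_cnf e (map cl Zs)" using cl(3) by (simp add: sat_cnf_def Zs)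
    assume *: "sat_cnf e (map cl Zs)"
    show "P e"
    proof (rule ccontr)
      assume "\<not> P e"
      then have "z e \<in> \<Z>" by (auto simp: \<Z>_def)
      then show False using cl(4)[of e] * by (auto simp: sat_cnf_def Zs)
    qed
  qed
  then have "P = (\<lambda>e. sat_cnf e (map cl Zs))" by blast
  then show ?thesis
    unfolding qf_horn_definable_Q_plus_def
    using cl(1,2) by (intro exI[of _ "map cl Zs"]) (simp add: horn_cnf_def Zs)
qed

section \<open>Boolean combinations via zero and nonzero codes\<close>

text \<open>Variable k is a code of the truth value of D. Demanding the equivalence, rather than
  only that D can be asserted, is what makes the notion stable under negation.\<close>

definition pp_bool :: "('s, rat) rel_structure \<Rightarrow> nat \<Rightarrow> ((nat \<Rightarrow> rat) \<Rightarrow> bool) \<Rightarrow> bool" where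
  "pp_bool \<Gamma> k D \<longleftrightarrow> (\<forall>e e'. (\<forall>i<k. e i = e' i) \<longrightarrow> D e = D e') \<and>
     pp_pred \<Gamma> (Suc k) (\<lambda>e. (e k \<noteq> 0) = D e)"

lemma pp_boolI:
  assumes "\<And>e e'. (\<And>i. i < k \<Longrightarrow> e i = e' i) \<Longrightarrow> D e = D e'"
    and "pp_pred \<Gamma> (Suc k) (\<lambda>e. (e k \<noteq> 0) = D e)"
  shows "pp_bool \<Gamma> k D"
  unfolding pp_bool_def using assms by blast

lemma pp_bool_cong: "pp_bool \<Gamma> k D \<Longrightarrow> (\<And>i. i < k \<Longrightarrow> e i = e' i) \<Longrightarrow> D e = D e'"
  unfolding pp_bool_def by blast

lemma pp_bool_graph:
  assumes "pp_bool \<Gamma> k D" "k \<le> m" "j < m"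
  shows "pp_pred \<Gamma> m (\<lambda>e. (e j \<noteq> 0) = D e)"
proof -
  define \<sigma> where "\<sigma> i = (if i < k then i else j)" for i
  have "pp_pred \<Gamma> m (\<lambda>e. (e (\<sigma> k) \<noteq> 0) = D (\<lambda>i. e (\<sigma> i)))"
    by (rule pp_pred_rename[of \<Gamma> "Suc k" "\<lambda>e. (e k \<noteq> 0) = D e"])
      (use assms in \<open>auto simp: pp_bool_def \<sigma>_def\<close>)
  moreover have "D (\<lambda>i. e (\<sigma> i)) = D e" for e
    by (rule pp_bool_cong[OF assms(1)]) (simp add: \<sigma>_def)
  ultimately show ?thesis by (simp add: \<sigma>_def)
qed

lemma pp_bool_mono: "pp_bool \<Gamma> k D \<Longrightarrow> k \<le> m \<Longrightarrow> pp_bool \<Gamma> m D"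
  using pp_bool_graph[of \<Gamma> k D "Suc m" m] unfolding pp_bool_def by auto

locale pp_plus_xor = pp_plus +
  assumes xor: "pp_pred \<Gamma> 2 (\<lambda>e. (e 0 = 0) \<noteq> (e 1 = 0))"
begin

lemma pp_pred_nonzero: "pp_fun \<Gamma> k L \<Longrightarrow> pp_pred \<Gamma> k (\<lambda>e. L e \<noteq> 0)"
  using pp_pred_subst2[OF xor, of k L "\<lambda>e. 0"] pp_fun_zero by simp

lemma pp_bool_True: "pp_bool \<Gamma> k (\<lambda>e. True)"
  using pp_pred_nonzero[OF pp_fun_var, of k "Suc k"] by (simp add: pp_bool_def)

lemma pp_bool_lin_zero: "pp_bool \<Gamma> k (\<lambda>e. lin {..<k} c e = 0)"
proof (rule pp_boolI)
  have "pp_pred \<Gamma> (Suc k) (\<lambda>e. (e k = 0) \<noteq> (lin {..<k} c e = 0))"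
    by (intro pp_pred_subst2[OF xor] pp_fun_var pp_fun_lin) auto
  moreover have "((e k = 0) \<noteq> (lin {..<k} c e = 0)) = ((e k \<noteq> 0) = (lin {..<k} c e = 0))" for e
    by blast
  ultimately show "pp_pred \<Gamma> (Suc k) (\<lambda>e. (e k \<noteq> 0) = (lin {..<k} c e = 0))" by simp
  show "(lin {..<k} c e = 0) = (lin {..<k} c e' = 0)" if "\<And>i. i < k \<Longrightarrow> e i = e' i" for e e'
    using lin_cong[of "{..<k}" e e' c] that by simp
qed

lemma pp_bool_not:
  assumes "pp_bool \<Gamma> k D"
  shows "pp_bool \<Gamma> k (\<lambda>e. \<not> D e)"
proof -
  \<comment> \<open>Variable \<open>Suc k\<close> is a code of D, to be quantified away;
    \<open>xor\<close> turns variable k into a code of the opposite value.\<close>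
  have "pp_pred \<Gamma> (Suc (Suc k)) (\<lambda>e. (e (Suc k) \<noteq> 0) = D e \<and> ((e k = 0) \<noteq> (e (Suc k) = 0)))"
    by (intro pp_pred_conj pp_bool_graph[OF assms] pp_pred_subst2[OF xor] pp_fun_var) auto
  moreover have "((w \<noteq> 0) = D e \<and> ((e k = 0) \<noteq> (w = 0))) = ((w \<noteq> 0) = D e' \<and> ((e' k = 0) \<noteq> (w = 0)))"
    if "\<And>i. i < Suc k \<Longrightarrow> e i = e' i" for e e' and w :: rat
    using that[of k] pp_bool_cong[OF assms, of e e'] that by simp
  ultimately have "pp_pred \<Gamma> (Suc k) (\<lambda>e. \<exists>w::rat. (w \<noteq> 0) = D e \<and> ((e k = 0) \<noteq> (w = 0)))"
    by (rule pp_pred_ex1[of \<Gamma> "Suc k" "\<lambda>e (w::rat). (w \<noteq> 0) = D e \<and> ((e k = 0) \<noteq> (w = 0))"])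
  moreover have "(\<exists>w::rat. (w \<noteq> 0) = D e \<and> ((e k = 0) \<noteq> (w = 0))) \<longleftrightarrow> (e k \<noteq> 0) = (\<not> D e)"
    for e :: "nat \<Rightarrow> rat"
    by (cases "D e") (auto intro: exI[of _ "1::rat"])
  ultimately show ?thesis using assms unfolding pp_bool_def by simp
qed

text \<open>
  Numbers that are nonzero exactly when the respective disjunct holds can be scaled freely, so their
  sum can be made nonzero as soon as one disjunct holds.
\<close>

lemma pp_pred_disj3:
  assumes D: "pp_bool \<Gamma> k D1" "pp_bool \<Gamma> k D2" "pp_bool \<Gamma> k D3"
  shows "pp_pred \<Gamma> k (\<lambda>e. D1 e \<or> D2 e \<or> D3 e)"
proof -
  define Q where "Q e \<longleftrightarrow> (e k \<noteq> 0) = D1 e \<and> (e (k + 1) \<noteq> 0) = D2 e \<and> (e (k + 2) \<noteq> 0) = D3 e \<and>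
    e k + e (k + 1) + e (k + 2) \<noteq> 0" for e
  have "pp_pred \<Gamma> (k + 3) Q"
    unfolding Q_def
    by (intro pp_pred_conj pp_bool_graph[OF D(1)] pp_bool_graph[OF D(2)] pp_bool_graph[OF D(3)]
        pp_pred_nonzero pp_fun_add pp_fun_var) auto
  moreover have "(\<exists>e'. (\<forall>i<k. e' i = e i) \<and> Q e') \<longleftrightarrow> D1 e \<or> D2 e \<or> D3 e" for e
  proof
    assume "\<exists>e'. (\<forall>i<k. e' i = e i) \<and> Q e'"
    then obtain e' where e': "\<And>i. i < k \<Longrightarrow> e' i = e i" "Q e'" by blast
    have "D1 e' = D1 e" "D2 e' = D2 e" "D3 e' = D3 e" by (rule D[THEN pp_bool_cong], rule e', simp)+
    then show "D1 e \<or> D2 e \<or> D3 e" using e'(2) unfolding Q_def by auto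
  next
    assume *: "D1 e \<or> D2 e \<or> D3 e"
    \<comment> \<open>The codes 0 and 1 are nonnegative, so their sum cannot cancel.\<close>
    define e' where "e' = e(k := of_bool (D1 e), k + 1 := of_bool (D2 e), k + 2 := of_bool (D3 e))"
    have e': "e' i = e i" if "i < k" for i using that by (simp add: e'_def)
    have "D1 e' = D1 e" "D2 e' = D2 e" "D3 e' = D3 e" by (rule D[THEN pp_bool_cong], rule e', simp)+
    then have "Q e'" using * by (auto simp: Q_def e'_def of_bool_def)
    then show "\<exists>e'. (\<forall>i<k. e' i = e i) \<and> Q e'" using e' by blast
  qed
  ultimately show ?thesis using pp_pred_ex[of \<Gamma> k 3 Q] by simp
qed

lemma pp_pred_if_pp_bool: "pp_bool \<Gamma> k D \<Longrightarrow> pp_pred \<Gamma> k D"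
  using pp_pred_disj3[of k D D D] by simp

text \<open>Adding codes of C and D would not do, since they may cancel when both hold. Instead, the
  equivalence between \<open>e k \<noteq> 0\<close> and the disjunction is split into three clauses.
  The longest has three literals, hence the arity of \<open>pp_pred_disj3\<close>; the others are
  padded by repeating a literal.\<close>

lemma pp_bool_disj:
  assumes C: "pp_bool \<Gamma> k C" and D: "pp_bool \<Gamma> k D"
  shows "pp_bool \<Gamma> k (\<lambda>e. C e \<or> D e)"
proof -
  have Suc: "pp_bool \<Gamma> (Suc k) C" "pp_bool \<Gamma> (Suc k) D"
    using C D by (auto intro: pp_bool_mono)
  have z: "pp_bool \<Gamma> (Suc k) (\<lambda>e. e k = 0)"
  proof (rule pp_boolI)
    have "pp_pred \<Gamma> (Suc (Suc k)) (\<lambda>e. (e (Suc k) = 0) \<noteq> (e k = 0))"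
      by (intro pp_pred_subst2[OF xor] pp_fun_var) auto
    moreover have "((e (Suc k) = 0) \<noteq> (e k = 0)) = ((e (Suc k) \<noteq> 0) = (e k = 0))" for e :: "nat \<Rightarrow> rat"
      by blast
    ultimately show "pp_pred \<Gamma> (Suc (Suc k)) (\<lambda>e. (e (Suc k) \<noteq> 0) = (e k = 0))" by simp
  qed simp
  note nz = pp_bool_not[OF z]
  have "pp_pred \<Gamma> (Suc k) (\<lambda>e. (e k = 0 \<or> C e \<or> D e) \<and> ((\<not> C e \<or> e k \<noteq> 0 \<or> e k \<noteq> 0) \<and>
      (\<not> D e \<or> e k \<noteq> 0 \<or> e k \<noteq> 0)))"
    by (intro pp_pred_conj pp_pred_disj3 pp_bool_not[of "Suc k"] Suc z nz)
  moreover have "(e k = 0 \<or> C e \<or> D e) \<and> ((\<not> C e \<or> e k \<noteq> 0 \<or> e k \<noteq> 0) \<and>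
      (\<not> D e \<or> e k \<noteq> 0 \<or> e k \<noteq> 0)) \<longleftrightarrow> (e k \<noteq> 0) = (C e \<or> D e)" for e
    by blast
  moreover have "(C e \<or> D e) = (C e' \<or> D e')" if "\<forall>i<k. e i = e' i" for e e'
    using pp_bool_cong[OF C, of e e'] pp_bool_cong[OF D, of e e'] that by simp
  ultimately show ?thesis unfolding pp_bool_def by simp
qed

lemma pp_bool_conj: "pp_bool \<Gamma> k C \<Longrightarrow> pp_bool \<Gamma> k D \<Longrightarrow> pp_bool \<Gamma> k (\<lambda>e. C e \<and> D e)"
  using pp_bool_not[OF pp_bool_disj[OF pp_bool_not pp_bool_not], of k C D] by simp

lemma pp_bool_ball:
  "finite I \<Longrightarrow> (\<And>i. i \<in> I \<Longrightarrow> pp_bool \<Gamma> k (D i)) \<Longrightarrow> pp_bool \<Gamma> k (\<lambda>e. \<forall>i\<in>I. D i e)"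
  by (induction I rule: finite_induct) (simp_all add: pp_bool_True pp_bool_conj)

lemma pp_bool_bex:
  "finite I \<Longrightarrow> (\<And>i. i \<in> I \<Longrightarrow> pp_bool \<Gamma> k (D i)) \<Longrightarrow> pp_bool \<Gamma> k (\<lambda>e. \<exists>i\<in>I. D i e)"
  using pp_bool_not[OF pp_bool_ball[OF _ pp_bool_not], of I k D] by simp

text \<open>A disjunctive normal form: one disjunct for each of the finitely many zero sets realised
  by P, stating for every form of F whether it vanishes.\<close>

lemma pp_pred_if_determined_by:
  assumes F: "determined_by {..<k} F P"
  shows "pp_pred \<Gamma> k P"
proof -
  define z where "z = zeros {..<k} F"
  define \<Z> where "\<Z> = z ` {e. P e}"
  have finF: "finite F" using F by (simp add: determined_by_def)
  have "\<Z> \<subseteq> Pow F" by (auto simp: \<Z>_def z_def zeros_def)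
  then have "finite \<Z>" using finF by (auto intro: finite_subset)
  moreover have "pp_bool \<Gamma> k (\<lambda>e. (lin {..<k} c e = 0) = (c \<in> Z))" for c Z
    using pp_bool_lin_zero[of k c] pp_bool_not[OF pp_bool_lin_zero[of k c]] by (cases "c \<in> Z") simp_all
  ultimately have "pp_bool \<Gamma> k (\<lambda>e. \<exists>Z\<in>\<Z>. \<forall>c\<in>F. (lin {..<k} c e = 0) = (c \<in> Z))"
    using finF by (intro pp_bool_bex pp_bool_ball)
  moreover have "(\<exists>Z\<in>\<Z>. \<forall>c\<in>F. (lin {..<k} c e = 0) = (c \<in> Z)) \<longleftrightarrow> P e" for e
  proof
    assume "\<exists>Z\<in>\<Z>. \<forall>c\<in>F. (lin {..<k} c e = 0) = (c \<in> Z)"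
    then obtain a where "P a" "\<forall>c\<in>F. (lin {..<k} c e = 0) = (c \<in> z a)" by (auto simp: \<Z>_def)
    then have "zeros {..<k} F e = zeros {..<k} F a" by (auto simp: z_def zeros_def)
    then show "P e" using determined_byD[OF F] \<open>P a\<close> by blast
  next
    assume "P e"
    then show "\<exists>Z\<in>\<Z>. \<forall>c\<in>F. (lin {..<k} c e = 0) = (c \<in> Z)"
      by (auto simp: \<Z>_def z_def zeros_def)
  qed
  ultimately show ?thesis using pp_pred_if_pp_bool by simp
qed

end

section \<open>Nonzero and exclusive-or from relations that violate the first two
  alternatives\<close>

context pp_plus
begin

text \<open>On the line through the origin and a, all points but the origin have the same zero set
  as a. Restricted to this line, P therefore says that the parameter is nonzero.\<close>

lemma pp_pred_nonzero_if_not_zero_valid: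
  assumes "pp_pred \<Gamma> k P" "determined_by V F P" "P a" "\<not> P (\<lambda>i. 0)"
  shows "pp_pred \<Gamma> 1 (\<lambda>e. e 0 \<noteq> 0)"
proof -
  have "pp_pred \<Gamma> 1 (\<lambda>e. P (\<lambda>i. a i * e 0))"
    by (rule pp_pred_subst[OF assms(1)]) (auto intro: pp_fun_mult pp_fun_var)
  moreover have "P (\<lambda>i. a i * e 0) \<longleftrightarrow> e 0 \<noteq> 0" for e :: "nat \<Rightarrow> rat"
    using determined_by_scale[OF assms(2), of "e 0" a] assms(3,4)
    by (cases "e 0 = 0") (simp_all add: mult.commute)
  ultimately show ?thesis by simp
qed

text \<open>
  The binary relation of all \<open>(x, y)\<close> for which \<open>x a + y b\<close> satisfies \<open>P\<close> consists of the two axes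
  and finitely many further lines through the origin, up to the origin itself. Intersecting it with
  a stretched copy of itself removes the further lines.
\<close>

lemma pp_pred_xor_if_not_inter_closed:
  assumes P: "pp_pred \<Gamma> k P" and F: "determined_by V F P" and ab: "P a" "P b"
    and no_inter: "\<And>d. P d \<Longrightarrow> zeros V F d \<noteq> zeros V F a \<inter> zeros V F b"
    and nz: "pp_pred \<Gamma> 1 (\<lambda>e. e 0 \<noteq> 0)"
  shows "pp_pred \<Gamma> 2 (\<lambda>e. (e 0 = 0) \<noteq> (e 1 = 0))"
proof -
  define T where "T x y \<longleftrightarrow> P (\<lambda>i. a i * x + b i * y)" for x y
  define M where "M = {t. T 1 t}"
  have scale: "T (s * x) (s * y) = T x y" if "s \<noteq> 0" for s x y
    using determined_by_scale[OF F that, of "\<lambda>i. a i * x + b i * y"]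
    by (simp add: T_def algebra_simps)
  have axes: "T x 0" "T 0 x" if "x \<noteq> 0" for x
    using determined_by_scale[OF F that, of a] determined_by_scale[OF F that, of b] ab
    by (simp_all add: T_def mult.commute)
  have "finite F" using F by (simp add: determined_by_def)
  \<comment> \<open>A slope t in M is exceptional: a + t b satisfies P, so by
    \<open>no_inter\<close> its zero set is not the intersection of those of a and b.\<close>
  then have finM: "finite M"
    unfolding M_def T_def using no_inter
    by (intro finite_subset[OF _ zeros_generic_comb[of F V a b]]) (auto simp: mult.commute)
  \<comment> \<open>If (x, y) and (x, c y) both lie in T off the axes, their slopes m and m' are in
    M and c = m' / m; such quotients are avoided. As c \<noteq> 0, the stretch maps each axis to
    itself.\<close>
  obtain c where c: "c \<notin> insert 0 ((\<lambda>(m, m'). m' / m) ` (M \<times> M))"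
    using ex_new_if_finite[OF infinite_UNIV_char_0] finM
    by (metis finite_SigmaI finite_imageI finite_insert)
  have M: "y / x \<in> M" if "T x y" "x \<noteq> 0" for x y
    using scale[of x 1 "y / x"] that by (simp add: M_def)
  \<comment> \<open>The condition \<open>x + y \<noteq> 0\<close> excludes the origin and costs no
    other point of the axes.\<close>
  have eq: "T x y \<and> T x (c * y) \<and> x + y \<noteq> 0 \<longleftrightarrow> (x = 0) \<noteq> (y = 0)" for x y
  proof
    assume *: "T x y \<and> T x (c * y) \<and> x + y \<noteq> 0"
    have False if "x \<noteq> 0" "y \<noteq> 0"
    proof -
      have "(y / x, c * y / x) \<in> M \<times> M" using * that M by auto
      moreover have "c = (c * y / x) / (y / x)" using that by simp
      ultimately have "c \<in> (\<lambda>(m, m'). m' / m) ` (M \<times> M)"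
        by (intro image_eqI[of _ _ "(y / x, c * y / x)"]) simp_all
      then show False using c by blast
    qed
    then show "(x = 0) \<noteq> (y = 0)" using * by auto
  next
    assume "(x = 0) \<noteq> (y = 0)"
    then show "T x y \<and> T x (c * y) \<and> x + y \<noteq> 0" using axes c by (cases "x = 0") auto
  qed
  have "pp_pred \<Gamma> 2 (\<lambda>e. T (e 0) (q * e 1))" for q
    unfolding T_def
    by (rule pp_pred_subst[OF P]) (intro pp_fun_add pp_fun_mult pp_fun_var, auto)
  from this[of 1] this[of c] have "pp_pred \<Gamma> 2 (\<lambda>e. T (e 0) (e 1))" "pp_pred \<Gamma> 2 (\<lambda>e. T (e 0) (c * e 1))"
    by simp_all
  moreover have "pp_pred \<Gamma> 2 (\<lambda>e. e 0 + e 1 \<noteq> 0)"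
    by (rule pp_pred_subst[OF nz, of 2 "\<lambda>_ e. e 0 + e 1"]) (intro pp_fun_add pp_fun_var, auto)
  ultimately have "pp_pred \<Gamma> 2 (\<lambda>e. T (e 0) (e 1) \<and> T (e 0) (c * e 1) \<and> e 0 + e 1 \<noteq> 0)"
    by (intro pp_pred_conj)
  then show ?thesis by (simp add: eq)
qed

end

section \<open>The three alternatives for an expansion\<close>

lemma pp_pred_rel: "pp_pred \<Gamma> (ar \<Gamma> r) (\<lambda>e. map e [0..<ar \<Gamma> r] \<in> rel \<Gamma> r)"
  using pp_pred_atomic[of \<Gamma> "Rel r [0..<ar \<Gamma> r]" "ar \<Gamma> r"] by (simp add: lessThan_atLeast0)

lemma pp_plus_if_expansion:
  assumes "fo_expansion_Q_plus \<Gamma>"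
  shows "pp_plus \<Gamma>"
proof
  obtain r where r: "ar \<Gamma> r = 3" "rel \<Gamma> r = plus_rel"
    using assms by (auto simp: fo_expansion_Q_plus_def)
  have "[0..<3] = [0, 1, 2]" by (simp add: upt_rec)
  then have "map e [0..<3] \<in> plus_rel \<longleftrightarrow> e 0 + e 1 = e 2" for e by (auto simp: plus_rel_def)
  then show "pp_pred \<Gamma> 3 (\<lambda>e. e 0 + e 1 = e 2)" using pp_pred_rel[of \<Gamma> r] r by simp
qed

theorem theorem4p5:
  fixes \<Gamma> :: "('s, rat) rel_structure"
  assumes "fo_expansion_Q_plus \<Gamma>"
  shows "(\<forall>r. qf_horn_definable_Q_plus (ar \<Gamma> r) (rel \<Gamma> r)) \<or>
         (\<forall>r. rel \<Gamma> r \<noteq> {} \<longrightarrow> replicate (ar \<Gamma> r) 0 \<in> rel \<Gamma> r) \<or>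
         (\<forall>k R. fo_definable Q_plus k R \<longrightarrow> pp_definable \<Gamma> k R)"
proof (intro disjCI)
  assume not_ii_iii: "\<not> ((\<forall>r. rel \<Gamma> r \<noteq> {} \<longrightarrow> replicate (ar \<Gamma> r) 0 \<in> rel \<Gamma> r) \<or>
         (\<forall>k R. fo_definable Q_plus k R \<longrightarrow> pp_definable \<Gamma> k R))"
  interpret pp_plus \<Gamma> using pp_plus_if_expansion[OF assms] .
  have fo: "fo_definable Q_plus (ar \<Gamma> r) (rel \<Gamma> r)" for r
    using assms by (auto simp: fo_expansion_Q_plus_def)
  \<comment> \<open>This relation only supplies the predicate x \<noteq> 0, which is then available
    when any other relation is examined.\<close>
  obtain r where r: "rel \<Gamma> r \<noteq> {}" "replicate (ar \<Gamma> r) 0 \<notin> rel \<Gamma> r" using not_ii_iii by blast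
  obtain F P where FP: "determined_by {..<ar \<Gamma> r} F P" "rel \<Gamma> r = defined_rel (ar \<Gamma> r) P"
    "\<And>e. map e [0..<ar \<Gamma> r] \<in> rel \<Gamma> r \<longleftrightarrow> P e"
    using fo_definable_determined[OF fo] by blast
  obtain a where "P a" using r(1) FP(2) by (auto simp: defined_rel_def)
  moreover have "\<not> P (\<lambda>i. 0)" using r(2) FP(3)[of "\<lambda>i. 0"] by (simp add: map_replicate_const)
  ultimately have nz: "pp_pred \<Gamma> 1 (\<lambda>e. e 0 \<noteq> 0)"
    using pp_pred_nonzero_if_not_zero_valid[OF _ FP(1)] pp_pred_rel[of \<Gamma> r] FP(3) by simp
  \<comment> \<open>Exclusive-or would make every definable relation primitive positive definable,
    against the failure of the third alternative.\<close>
  have not_xor: "\<not> pp_pred \<Gamma> 2 (\<lambda>e. (e 0 = 0) \<noteq> (e 1 = 0))"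
  proof
    assume "pp_pred \<Gamma> 2 (\<lambda>e. (e 0 = 0) \<noteq> (e 1 = 0))"
    then interpret pp_plus_xor \<Gamma> by unfold_locales
    have "pp_definable \<Gamma> k R" if "fo_definable Q_plus k R" for k R
      using fo_definable_determined[OF that] pp_pred_if_determined_by pp_definable_if_pp_pred by metis
    then show False using not_ii_iii by blast
  qed
  show "\<forall>r. qf_horn_definable_Q_plus (ar \<Gamma> r) (rel \<Gamma> r)"
  proof
    fix r
    obtain F P where FP: "determined_by {..<ar \<Gamma> r} F P" "rel \<Gamma> r = defined_rel (ar \<Gamma> r) P"
      "\<And>e. map e [0..<ar \<Gamma> r] \<in> rel \<Gamma> r \<longleftrightarrow> P e"
      using fo_definable_determined[OF fo] by blast
    have "pp_pred \<Gamma> (ar \<Gamma> r) P" using pp_pred_rel[of \<Gamma> r] FP(3) by simp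
    \<comment> \<open>Solutions a, b whose common zeros are the zero set of no solution would define
      exclusive-or, so the zero sets are closed under intersection.\<close>
    then show "qf_horn_definable_Q_plus (ar \<Gamma> r) (rel \<Gamma> r)"
      unfolding FP(2)
      using pp_pred_xor_if_not_inter_closed[OF _ FP(1) _ _ _ nz] not_xor
      by (intro qf_horn_definable_if_zeros_inter_closed[OF FP(1)]) blast
  qed
qed

end
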